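(* Let $0<\epsilon\le2^{-50}$ and $n=2^{2^{-45}\epsilon^{-2}}$. There is an edge-weighted bipartite graph $G$ with parts $U,V$, $|U|=|V|=n$, and weights in $[0,1]$ such that no partitions $P_1:U=U_1\cup\dots\cup U_k$ of $U$ with $k\le n/2$ and $P_2:V=V_1\cup\dots\cup V_{k'}$ of $V$ (with any $k'$) form a weak $\epsilon$-regular partition of $G$. Consequently $k_0(\epsilon)>2^{2^{-46}\epsilon^{-2}}$.
   Context: For a weighted bipartite graph $G$ on $U\cup V$ with weights $w(u,v)\in[0,1]$, $e_w(A,B)=\sum_{a\in A,b\in B}w(a,b)$ and $d_w(A,B)=e_w(A,B)/(|A||B|)$. For partitions $P_1$ of $U$ and $P_2$ of $V$, $f_{P_1,P_2}(A,B)=e_w(A,B)-\sum_{i,j}d_w(U_i,V_j)|U_i\cap A||V_j\cap B|$; the pair $P_1,P_2$ forms a weak $\epsilon$-regular partition if $|f_{P_1,P_2}(A,B)|\le\epsilon n^2$ for all $A\subset U$, $B\subset V$. $k_0(\epsilon)$ denotes the least integer such that every edge-weighted bipartite graph with weights in $[0,1]$ and two parts of equal size has partitions $P_1$, $P_2$ of its two parts, each with at most $k_0(\epsilon)$ parts, forming a weak $\epsilon$-regular partition. ($n$ is rounded to an integer.) *)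

theory Defs
  imports Complex_Main "HOL-Library.Disjoint_Sets"
begin

text \<open>Only the values of \<open>w u v\<close> with \<open>u \<in> U\<close>, \<open>v \<in> V\<close> are relevant.\<close>

definition weighted_bipartite :: "'a set \<Rightarrow> 'a set \<Rightarrow> ('a \<Rightarrow> 'a \<Rightarrow> real) \<Rightarrow> bool" where
  "weighted_bipartite U V w \<longleftrightarrow>
     finite U \<and> finite V \<and> U \<inter> V = {} \<and> (\<forall>u\<in>U. \<forall>v\<in>V. 0 \<le> w u v \<and> w u v \<le> 1)"

definition edge_weight :: "('a \<Rightarrow> 'a \<Rightarrow> real) \<Rightarrow> 'a set \<Rightarrow> 'a set \<Rightarrow> real" where
  "edge_weight w A B = (\<Sum>a\<in>A. \<Sum>b\<in>B. w a b)"

definition density :: "('a \<Rightarrow> 'a \<Rightarrow> real) \<Rightarrow> 'a set \<Rightarrow> 'a set \<Rightarrow> real" where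
  "density w A B = edge_weight w A B / (real (card A) * real (card B))"

definition discrepancy ::
  "('a \<Rightarrow> 'a \<Rightarrow> real) \<Rightarrow> 'a set set \<Rightarrow> 'a set set \<Rightarrow> 'a set \<Rightarrow> 'a set \<Rightarrow> real" where
  "discrepancy w P1 P2 A B =
     edge_weight w A B
     - (\<Sum>X\<in>P1. \<Sum>Y\<in>P2. density w X Y * real (card (X \<inter> A)) * real (card (Y \<inter> B)))"

text \<open>The notion is only used for two parts of equal size, so that \<open>n = card U = card V\<close>.\<close>

definition weak_regular_partition ::
  "real \<Rightarrow> 'a set \<Rightarrow> 'a set \<Rightarrow> ('a \<Rightarrow> 'a \<Rightarrow> real) \<Rightarrow> 'a set set \<Rightarrow> 'a set set \<Rightarrow> bool" where
  "weak_regular_partition \<epsilon> U V w P1 P2 \<longleftrightarrow>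
     partition_on U P1 \<and> partition_on V P2 \<and>
     (\<forall>A B. A \<subseteq> U \<longrightarrow> B \<subseteq> V \<longrightarrow> \<bar>discrepancy w P1 P2 A B\<bar> \<le> \<epsilon> * (real (card U))\<^sup>2)"

text \<open>Vertices are taken to be natural numbers, which covers every finite graph up to isomorphism.
  For \<open>\<epsilon> > 0\<close> a suitable \<open>k\<close> exists by the Frieze--Kannan weak regularity lemma.\<close>

definition k0 :: "real \<Rightarrow> nat" where
  "k0 \<epsilon> = (LEAST k. \<forall>(U :: nat set) V w. weighted_bipartite U V w \<and> card U = card V \<longrightarrow>
     (\<exists>P1 P2. card P1 \<le> k \<and> card P2 \<le> k \<and> weak_regular_partition \<epsilon> U V w P1 P2))"

end

theory Submission
  imports Defs
begin

text \<open>Let \<open>r = \<lfloor>log\<^sub>2 n\<rfloor>\<close>. Give the vertices \<open>u \<in> U\<close> vectors \<open>x\<^sub>u\<close> with small integer entries and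
  pairwise Hamming distance more than \<open>r div 4\<close> (a Gilbert--Varshamov code), give \<open>v \<in> V\<close> the sign
  vector \<open>y\<^sub>v\<close> of its last \<open>r\<close> bits, and let \<open>w(u,v)\<close> be \<open>1/2 + \<alpha> \<langle>x\<^sub>u, y\<^sub>v\<rangle>\<close> truncated to \<open>[0,1]\<close>, where
  \<open>\<alpha>\<close> is of order \<open>1/\<surd>r\<close>. Put \<open>F\<^sub>i(u) = \<Sum>\<^sub>v y\<^sub>v(i) (w(u,v) - d(u,v))\<close>, where \<open>d\<close> is the density of the pair of
  parts containing \<open>u, v\<close>. If \<open>u, u'\<close> lie in the same part, \<open>d\<close> cancels from \<open>F\<^sub>i(u) - F\<^sub>i(u')\<close>, and
  \<open>\<Sum>\<^sub>i (x\<^sub>u(i) - x\<^sub>u\<^sub>'(i)) (F\<^sub>i(u) - F\<^sub>i(u')) = \<Sum>\<^sub>v \<langle>x\<^sub>u - x\<^sub>u\<^sub>', y\<^sub>v\<rangle> (w(u,v) - w(u',v))\<close>. Its terms are nonnegative, as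
  truncation is monotone, and second and fourth moments of Rademacher sums bound it below by a
  multiple of \<open>n \<surd>r\<close>. So in each part all vertices \<open>u\<close> but one have \<open>\<Sum>\<^sub>i \<bar>F\<^sub>i(u)\<bar>\<close> of order at least \<open>n \<surd>r\<close>,
  whereas weak regularity gives \<open>\<Sum>\<^sub>u \<bar>F\<^sub>i(u)\<bar> \<le> 4 \<epsilon> n\<^sup>2\<close> for each \<open>i\<close>. With at most \<open>n/2\<close> parts this forces
  \<open>\<epsilon> \<surd>r \<ge> 2\<^sup>-\<^sup>2\<^sup>0\<close>.

  The bound on \<open>k0\<close> also needs that the least \<open>k\<close> in its definition ranges over a nonempty set, that
  is, the Frieze--Kannan weak regularity lemma; it is proved by energy increment.\<close>

section \<open>Discrepancy as a sum over pairs of vertices\<close>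

lemma sum_card_inter_partition:
  fixes h :: "'a set \<Rightarrow> real"
  assumes P: "partition_on U P" and fin: "finite U" and A: "A \<subseteq> U"
    and p: "\<And>u. u \<in> U \<Longrightarrow> p u \<in> P \<and> u \<in> p u"
  shows "(\<Sum>X\<in>P. h X * real (card (X \<inter> A))) = (\<Sum>u\<in>A. h (p u))"
proof -
  have finP: "finite P" using P fin by (rule finite_elements[rotated])
  have finA: "finite A" using A fin finite_subset by blast
  have "(\<Sum>u\<in>A. h (p u)) = (\<Sum>X\<in>P. \<Sum>u\<in>{u\<in>A. p u = X}. h (p u))"
    by (rule sum.group[symmetric]) (use finA finP p A in auto)
  also have "\<dots> = (\<Sum>X\<in>P. h X * real (card (X \<inter> A)))"
  proof (rule sum.cong[OF refl])
    fix X assume X: "X \<in> P"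
    have "{u\<in>A. p u = X} = X \<inter> A"
    proof -
      have "p u = X" if "u \<in> X" "u \<in> A" for u
        using partition_onD2[OF P] p[of u] that X A unfolding disjoint_def by blast
      then show ?thesis using p A by blast
    qed
    then show "(\<Sum>u\<in>{u\<in>A. p u = X}. h (p u)) = h X * real (card (X \<inter> A))"
      by (smt (verit, best) mem_Collect_eq mult.commute sum.cong sum_constant)
  qed
  finally show ?thesis by simp
qed

lemma partition_on_part_function:
  assumes "partition_on U P"
  obtains p where "\<And>u. u \<in> U \<Longrightarrow> p u \<in> P \<and> u \<in> p u"
proof -
  have "\<forall>u\<in>U. \<exists>X. X \<in> P \<and> u \<in> X" using partition_onD1[OF assms] by blast
  then show ?thesis using that by metis
qed

text \<open>With part functions \<open>p\<close> and \<open>q\<close> in place of sums over parts,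
  the discrepancy is additive in \<open>A\<close> and in \<open>B\<close>, so sets can be cut and
  recombined freely.\<close>

lemma discrepancy_eq_sum:
  assumes P1: "partition_on U P1" and P2: "partition_on V P2"
    and fin: "finite U" "finite V" and AB: "A \<subseteq> U" "B \<subseteq> V"
    and p: "\<And>u. u \<in> U \<Longrightarrow> p u \<in> P1 \<and> u \<in> p u"
    and q: "\<And>v. v \<in> V \<Longrightarrow> q v \<in> P2 \<and> v \<in> q v"
  shows "discrepancy w P1 P2 A B = (\<Sum>u\<in>A. \<Sum>v\<in>B. w u v - density w (p u) (q v))"
proof -
  have "(\<Sum>X\<in>P1. \<Sum>Y\<in>P2. density w X Y * real (card (X \<inter> A)) * real (card (Y \<inter> B)))
     = (\<Sum>X\<in>P1. (\<Sum>Y\<in>P2. density w X Y * real (card (Y \<inter> B))) * real (card (X \<inter> A)))"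
    by (simp add: sum_distrib_left sum_distrib_right mult_ac)
  also have "\<dots> = (\<Sum>u\<in>A. (\<Sum>Y\<in>P2. density w (p u) Y * real (card (Y \<inter> B))))"
    by (rule sum_card_inter_partition[OF P1 fin(1) AB(1) p])
  also have "\<dots> = (\<Sum>u\<in>A. \<Sum>v\<in>B. density w (p u) (q v))"
    by (intro sum.cong refl sum_card_inter_partition[OF P2 fin(2) AB(2) q])
  finally show ?thesis
    by (simp add: discrepancy_def edge_weight_def sum_subtractf)
qed

text \<open>Cutting \<open>U\<close> by the sign of the inner sum and \<open>V\<close> by the sign
  of \<open>t\<close> leaves four rectangles. Each contributes a discrepancy up to sign, which gives
  the factor 4.\<close>

lemma weak_regular_signed_sum_le:
  fixes t :: "'a \<Rightarrow> real"
  assumes reg: "weak_regular_partition \<epsilon> U V w P1 P2"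
    and fin: "finite U" "finite V"
    and p: "\<And>u. u \<in> U \<Longrightarrow> p u \<in> P1 \<and> u \<in> p u"
    and q: "\<And>v. v \<in> V \<Longrightarrow> q v \<in> P2 \<and> v \<in> q v"
    and t: "\<And>v. v \<in> V \<Longrightarrow> t v = 1 \<or> t v = -1"
  shows "(\<Sum>u\<in>U. \<bar>\<Sum>v\<in>V. t v * (w u v - density w (p u) (q v))\<bar>) \<le> 4 * \<epsilon> * (real (card U))\<^sup>2"
proof -
  have P1: "partition_on U P1" and P2: "partition_on V P2"
    using reg by (auto simp: weak_regular_partition_def)
  define g where "g u v = w u v - density w (p u) (q v)" for u v
  define F where "F u = (\<Sum>v\<in>V. t v * g u v)" for u
  define A where "A = {u\<in>U. 0 \<le> F u}"
  define B where "B = {v\<in>V. t v = 1}"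
  have D: "\<bar>\<Sum>u\<in>A'. \<Sum>v\<in>B'. g u v\<bar> \<le> \<epsilon> * (real (card U))\<^sup>2"
    if "A' \<subseteq> U" "B' \<subseteq> V" for A' B'
  proof -
    have "\<bar>discrepancy w P1 P2 A' B'\<bar> \<le> \<epsilon> * (real (card U))\<^sup>2"
      using reg that by (auto simp: weak_regular_partition_def)
    moreover have "discrepancy w P1 P2 A' B' = (\<Sum>u\<in>A'. \<Sum>v\<in>B'. g u v)"
      unfolding g_def by (rule discrepancy_eq_sum[OF P1 P2 fin that p q])
    ultimately show ?thesis by simp
  qed
  have F: "F u = (\<Sum>v\<in>B. g u v) - (\<Sum>v\<in>V - B. g u v)" for u
  proof -
    have "F u = (\<Sum>v\<in>V - B. t v * g u v) + (\<Sum>v\<in>B. t v * g u v)"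
      unfolding F_def by (rule sum.subset_diff) (auto simp: B_def fin)
    moreover have "(\<Sum>v\<in>V - B. t v * g u v) = (\<Sum>v\<in>V - B. - g u v)"
    proof (rule sum.cong[OF refl])
      fix v assume "v \<in> V - B"
      then have "t v = -1" using t[of v] by (auto simp: B_def)
      then show "t v * g u v = - g u v" by simp
    qed
    moreover have "(\<Sum>v\<in>B. t v * g u v) = (\<Sum>v\<in>B. g u v)"
      by (rule sum.cong) (auto simp: B_def)
    ultimately show ?thesis by (simp add: sum_negf)
  qed
  have "(\<Sum>u\<in>U. \<bar>F u\<bar>) = (\<Sum>u\<in>U - A. \<bar>F u\<bar>) + (\<Sum>u\<in>A. \<bar>F u\<bar>)"
    by (rule sum.subset_diff) (auto simp: A_def fin)
  also have "(\<Sum>u\<in>U - A. \<bar>F u\<bar>) = (\<Sum>u\<in>U - A. - F u)"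
    by (rule sum.cong) (auto simp: A_def)
  also have "(\<Sum>u\<in>A. \<bar>F u\<bar>) = (\<Sum>u\<in>A. F u)"
    by (rule sum.cong) (auto simp: A_def)
  also have "(\<Sum>u\<in>U - A. - F u) + (\<Sum>u\<in>A. F u) =
     (\<Sum>u\<in>A. \<Sum>v\<in>B. g u v) - (\<Sum>u\<in>A. \<Sum>v\<in>V - B. g u v)
      - (\<Sum>u\<in>U - A. \<Sum>v\<in>B. g u v) + (\<Sum>u\<in>U - A. \<Sum>v\<in>V - B. g u v)"
    by (simp add: F sum_subtractf)
  also have "\<dots> \<le> 4 * (\<epsilon> * (real (card U))\<^sup>2)"
    using D[of A B] D[of A "V - B"] D[of "U - A" B] D[of "U - A" "V - B"]
    by (simp add: A_def B_def)
  finally show ?thesis by (simp add: F_def g_def)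
qed

section \<open>Rademacher sums and their moments\<close>

text \<open>As \<open>v\<close> runs through \<open>{..<2 ^ r}\<close>, its first \<open>r\<close>
  bits give every sign vector exactly once. Averages over \<open>v\<close> are thus expectations
  over independent random signs, without any probability space.\<close>

definition bit_sign :: "nat \<Rightarrow> nat \<Rightarrow> real" where
  "bit_sign v i = (if bit v i then 1 else -1)"

definition sign_sum :: "nat \<Rightarrow> (nat \<Rightarrow> real) \<Rightarrow> nat \<Rightarrow> real" where
  "sign_sum r a v = (\<Sum>i<r. a i * bit_sign v i)"

lemma bit_sign_add_mult:
  assumes "i < r"
  shows "bit_sign (v + k * 2 ^ r) i = bit_sign v i"
proof -
  have "take_bit r (v + k * 2 ^ r) = take_bit r v"
    by (simp add: take_bit_eq_mod)
  then have "bit (v + k * 2 ^ r) i = bit v i"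
    using assms by (metis bit_take_bit_iff)
  then show ?thesis by (simp add: bit_sign_def)
qed

lemma sign_sum_add_mult: "sign_sum r a (v + k * 2 ^ r) = sign_sum r a v"
  by (simp add: sign_sum_def bit_sign_add_mult)

text \<open>Serves the inductions on \<open>r\<close>: for \<open>v < 2 ^ r\<close>, the numbers
  \<open>v\<close> and \<open>v + 2 ^ r\<close> differ only in bit \<open>r\<close>, so the two
  halves are the two values of the new sign.\<close>

lemma sum_lessThan_power_Suc:
  fixes f :: "nat \<Rightarrow> real"
  shows "sum f {..<2 ^ Suc r} = (\<Sum>v<2 ^ r. f v + f (v + 2 ^ r))"
proof -
  have "sum f {..<2 ^ Suc r} = sum f {..<2 ^ r} + sum f {2 ^ r..<2 ^ r + 2 ^ r}"
    by (simp add: mult_2 lessThan_atLeast0 sum.atLeastLessThan_concat)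
  also have "sum f {2 ^ r..<2 ^ r + 2 ^ r} = (\<Sum>v<2 ^ r. f (v + 2 ^ r))"
    using sum.shift_bounds_nat_ivl[of f 0 "2^r" "2^r"] by (simp add: lessThan_atLeast0)
  finally show ?thesis by (simp add: sum.distrib)
qed

lemma sign_sum_Suc:
  assumes "v < 2 ^ r"
  shows "sign_sum (Suc r) a v = sign_sum r a v - a r"
    and "sign_sum (Suc r) a (v + 2 ^ r) = sign_sum r a v + a r"
proof -
  have "\<not> bit v r" using assms by (simp add: bit_iff_odd)
  then show "sign_sum (Suc r) a v = sign_sum r a v - a r"
    by (simp add: sign_sum_def bit_sign_def)
  have "bit (v + 2 ^ r) r" using assms by (simp add: bit_iff_odd)
  then show "sign_sum (Suc r) a (v + 2 ^ r) = sign_sum r a v + a r"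
    using sign_sum_add_mult[of r a v 1] by (simp add: sign_sum_def bit_sign_def)
qed

lemma sign_sum_second_moment:
  "(\<Sum>v<2 ^ r. (sign_sum r a v)\<^sup>2) = 2 ^ r * (\<Sum>i<r. (a i)\<^sup>2)"
proof (induction r)
  case 0
  show ?case by (simp add: sign_sum_def)
next
  case (Suc r)
  have "(\<Sum>v<2 ^ Suc r. (sign_sum (Suc r) a v)\<^sup>2)
      = (\<Sum>v<2 ^ r. 2 * (sign_sum r a v)\<^sup>2 + 2 * (a r)\<^sup>2)"
    unfolding sum_lessThan_power_Suc
    by (rule sum.cong) (simp_all add: sign_sum_Suc power2_sum power2_diff)
  also have "\<dots> = 2 * (\<Sum>v<2 ^ r. (sign_sum r a v)\<^sup>2) + 2 ^ Suc r * (a r)\<^sup>2"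
    by (simp add: sum.distrib sum_distrib_left)
  finally show ?case by (simp add: Suc.IH algebra_simps)
qed

text \<open>Khinchine's inequality for the fourth moment, with constant 3. In the induction the odd
  powers of the new coefficient cancel between the two signs.\<close>

lemma sign_sum_fourth_moment:
  "(\<Sum>v<2 ^ r. (sign_sum r a v) ^ 4) \<le> 2 ^ r * (3 * (\<Sum>i<r. (a i)\<^sup>2)\<^sup>2)"
proof (induction r)
  case 0
  show ?case by (simp add: sign_sum_def)
next
  case (Suc r)
  define S where "S = (\<Sum>i<r. (a i)\<^sup>2)"
  have "(\<Sum>v<2 ^ Suc r. (sign_sum (Suc r) a v) ^ 4)
      = (\<Sum>v<2 ^ r. 2 * (sign_sum r a v) ^ 4 + 12 * (a r)\<^sup>2 * (sign_sum r a v)\<^sup>2 + 2 * (a r) ^ 4)"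
    unfolding sum_lessThan_power_Suc
    by (rule sum.cong) (simp_all add: sign_sum_Suc power2_eq_square power4_eq_xxxx algebra_simps)
  also have "\<dots> = 2 * (\<Sum>v<2 ^ r. (sign_sum r a v) ^ 4)
      + 12 * (a r)\<^sup>2 * (\<Sum>v<2 ^ r. (sign_sum r a v)\<^sup>2) + 2 ^ Suc r * (a r) ^ 4"
    by (simp add: sum.distrib sum_distrib_left)
  \<comment> \<open>Enlarging the last term by the factor 3 completes the square.\<close>
  also have "\<dots> \<le> 2 * (2 ^ r * (3 * S\<^sup>2)) + 12 * (a r)\<^sup>2 * (2 ^ r * S) + 2 ^ Suc r * (3 * (a r) ^ 4)"
    using Suc.IH by (intro add_mono mult_left_mono) (auto simp: sign_sum_second_moment S_def)
  also have "\<dots> = 2 ^ Suc r * (3 * (S + (a r)\<^sup>2)\<^sup>2)"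
    by (simp add: power2_eq_square power4_eq_xxxx algebra_simps)
  finally show ?case by (simp add: S_def)
qed

text \<open>Keeps the full periods and drops the nonnegative rest. This handles an \<open>n\<close>
  that is not a power of two.\<close>

lemma sum_periodic_ge:
  fixes h :: "nat \<Rightarrow> real"
  assumes per: "\<And>v k. h (v + k * m) = h v" and nn: "\<And>v. 0 \<le> h v"
  shows "real (n div m) * (\<Sum>v<m. h v) \<le> (\<Sum>v<n. h v)"
proof -
  have "(\<Sum>v<n div m * m. h v) = (\<Sum>k<n div m. sum h {k * m..<k * m + m})"
    by (rule sum.nat_group[symmetric])
  also have "\<dots> = (\<Sum>k<n div m. \<Sum>v<m. h v)"
  proof (rule sum.cong[OF refl])
    fix k
    show "sum h {k * m..<k * m + m} = (\<Sum>v<m. h v)"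
      using sum.shift_bounds_nat_ivl[of h 0 "k * m" m]
      by (simp add: lessThan_atLeast0 per add.commute)
  qed
  also have "\<dots> = real (n div m) * (\<Sum>v<m. h v)" by simp
  finally have "real (n div m) * (\<Sum>v<m. h v) = (\<Sum>v<n div m * m. h v)" by simp
  also have "\<dots> \<le> (\<Sum>v<n. h v)"
    by (rule sum_mono2) (use nn in \<open>auto intro: order.strict_trans2[OF _ div_times_less_eq_dividend]\<close>)
  finally show ?thesis .
qed

section \<open>Truncated weights and their correlation with the sign sums\<close>

definition clip :: "real \<Rightarrow> real" where
  "clip s = max 0 (min 1 (1 / 2 + s))"

lemma clip_bounds: "0 \<le> clip s" "clip s \<le> 1"
  by (auto simp: clip_def)

lemma clip_monotone_product: "0 \<le> \<alpha> \<Longrightarrow> 0 \<le> (s - t) * (clip (\<alpha> * s) - clip (\<alpha> * t))"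
proof -
  assume a: "0 \<le> \<alpha>"
  have m: "x \<le> y \<Longrightarrow> clip x \<le> clip y" for x y by (auto simp: clip_def)
  show ?thesis
  proof (cases "s \<le> t")
    case True
    with a m[of "\<alpha> * s" "\<alpha> * t"] show ?thesis
      by (simp add: mult_left_mono mult_nonpos_nonpos)
  next
    case False
    with a m[of "\<alpha> * t" "\<alpha> * s"] show ?thesis
      by (simp add: mult_left_mono)
  qed
qed

text \<open>If no truncation occurs, the left-hand side is \<open>\<alpha> (s - t)\<^sup>2\<close>; otherwise \<open>s\<close> or \<open>t\<close> is so
  large that the right-hand side is not positive.\<close>

lemma clip_product_ge:
  assumes a: "0 < \<alpha>"
  shows "\<alpha> * ((s - t)\<^sup>2 - 16 * \<alpha>\<^sup>2 * (s ^ 4 + t ^ 4))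
           \<le> (s - t) * (clip (\<alpha> * s) - clip (\<alpha> * t))"
proof (cases "\<bar>\<alpha> * s\<bar> \<le> 1 / 2 \<and> \<bar>\<alpha> * t\<bar> \<le> 1 / 2")
  case True
  then have "clip (\<alpha> * s) = 1 / 2 + \<alpha> * s" "clip (\<alpha> * t) = 1 / 2 + \<alpha> * t"
    by (auto simp: clip_def)
  then have "(s - t) * (clip (\<alpha> * s) - clip (\<alpha> * t)) = \<alpha> * (s - t)\<^sup>2"
    by (simp add: power2_eq_square algebra_simps)
  moreover have "0 \<le> 16 * \<alpha>\<^sup>2 * (s ^ 4 + t ^ 4)" by simp
  ultimately show ?thesis using a by (simp add: mult_left_mono)
next
  case False
  define m where "m = max \<bar>s\<bar> \<bar>t\<bar>"
  have m: "\<alpha> * m > 1 / 2"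
  proof -
    have "\<alpha> * \<bar>s\<bar> \<le> \<alpha> * m" "\<alpha> * \<bar>t\<bar> \<le> \<alpha> * m"
      using a by (auto simp: m_def)
    moreover have "1 / 2 < \<alpha> * \<bar>s\<bar> \<or> 1 / 2 < \<alpha> * \<bar>t\<bar>"
      using False a by (auto simp: abs_mult)
    ultimately show ?thesis by linarith
  qed
  have "(s - t)\<^sup>2 \<le> (2 * m)\<^sup>2"
    by (rule abs_le_square_iff[THEN iffD1]) (auto simp: m_def)
  also have "(2 * m)\<^sup>2 = (1 / 4) * (16 * m\<^sup>2)" by (simp add: power2_eq_square)
  \<comment> \<open>Truncation means \<open>\<alpha> * m > 1 / 2\<close>, so a factor 1/4 may be
    traded for \<open>(\<alpha> * m)\<^sup>2\<close>, turning the square into a fourth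
    power.\<close>
  also have "\<dots> \<le> (\<alpha> * m)\<^sup>2 * (16 * m\<^sup>2)"
  proof (rule mult_right_mono)
    have "(1 / 2)\<^sup>2 \<le> (\<alpha> * m)\<^sup>2" using m by (intro power_mono) auto
    then show "1 / 4 \<le> (\<alpha> * m)\<^sup>2" by (simp add: power2_eq_square)
  qed simp
  also have "\<dots> = 16 * \<alpha>\<^sup>2 * m ^ 4" by (simp add: power2_eq_square power4_eq_xxxx)
  also have "\<dots> \<le> 16 * \<alpha>\<^sup>2 * (s ^ 4 + t ^ 4)"
    by (intro mult_left_mono) (auto simp: m_def max_def power_even_abs)
  finally have "\<alpha> * ((s - t)\<^sup>2 - 16 * \<alpha>\<^sup>2 * (s ^ 4 + t ^ 4)) \<le> 0"
    using a by (simp add: mult_le_0_iff)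
  then show ?thesis using clip_monotone_product[of \<alpha> s t] a by linarith
qed

text \<open>The pointwise bound \<open>clip_product_ge\<close> is summed over one period, using the
  exact second moment of the difference and the fourth moment bounds (48 = 16 * 3). The other full
  periods repeat it, and the remainder is nonnegative by monotonicity of
  \<open>clip\<close>.\<close>

lemma clip_sign_sum_correlation_ge:
  assumes a: "0 < \<alpha>"
  shows "real (n div 2 ^ r) * 2 ^ r * (\<alpha> * ((\<Sum>i<r. (x i - y i)\<^sup>2)
             - 48 * \<alpha>\<^sup>2 * ((\<Sum>i<r. (x i)\<^sup>2)\<^sup>2 + (\<Sum>i<r. (y i)\<^sup>2)\<^sup>2)))
     \<le> (\<Sum>v<n. (sign_sum r x v - sign_sum r y v) *
               (clip (\<alpha> * sign_sum r x v) - clip (\<alpha> * sign_sum r y v)))"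
    (is "_ \<le> (\<Sum>v<n. ?h v)")
proof -
  let ?s = "sign_sum r x" and ?t = "sign_sum r y"
  have diff: "?s v - ?t v = sign_sum r (\<lambda>i. x i - y i) v" for v
    by (simp add: sign_sum_def sum_subtractf algebra_simps)
  have "2 ^ r * (\<alpha> * ((\<Sum>i<r. (x i - y i)\<^sup>2)
          - 48 * \<alpha>\<^sup>2 * ((\<Sum>i<r. (x i)\<^sup>2)\<^sup>2 + (\<Sum>i<r. (y i)\<^sup>2)\<^sup>2)))
      = \<alpha> * (2 ^ r * (\<Sum>i<r. (x i - y i)\<^sup>2)
          - 16 * \<alpha>\<^sup>2 * (2 ^ r * (3 * (\<Sum>i<r. (x i)\<^sup>2)\<^sup>2) + 2 ^ r * (3 * (\<Sum>i<r. (y i)\<^sup>2)\<^sup>2)))"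
    by (simp add: algebra_simps)
  also have "\<dots> \<le> \<alpha> * ((\<Sum>v<2 ^ r. (?s v - ?t v)\<^sup>2)
          - 16 * \<alpha>\<^sup>2 * ((\<Sum>v<2 ^ r. ?s v ^ 4) + (\<Sum>v<2 ^ r. ?t v ^ 4)))"
    unfolding diff sign_sum_second_moment using a
    by (intro mult_left_mono diff_mono order_refl add_mono sign_sum_fourth_moment) auto
  also have "\<dots> = (\<Sum>v<2 ^ r. \<alpha> * ((?s v - ?t v)\<^sup>2 - 16 * \<alpha>\<^sup>2 * (?s v ^ 4 + ?t v ^ 4)))"
    by (simp add: sum_distrib_left sum_subtractf sum.distrib right_diff_distrib distrib_left)
  also have "\<dots> \<le> (\<Sum>v<2 ^ r. ?h v)"
    by (intro sum_mono clip_product_ge a)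
  finally have "real (n div 2 ^ r) * (2 ^ r * (\<alpha> * ((\<Sum>i<r. (x i - y i)\<^sup>2)
          - 48 * \<alpha>\<^sup>2 * ((\<Sum>i<r. (x i)\<^sup>2)\<^sup>2 + (\<Sum>i<r. (y i)\<^sup>2)\<^sup>2))))
      \<le> real (n div 2 ^ r) * (\<Sum>v<2 ^ r. ?h v)"
    by (rule mult_left_mono) simp
  also have "\<dots> \<le> (\<Sum>v<n. ?h v)"
    by (rule sum_periodic_ge) (use a in \<open>auto simp: sign_sum_add_mult intro: clip_monotone_product\<close>)
  finally show ?thesis by (simp add: mult.assoc)
qed

section \<open>Gilbert-Varshamov codes\<close>

definition hamming :: "nat \<Rightarrow> (nat \<Rightarrow> nat) \<Rightarrow> (nat \<Rightarrow> nat) \<Rightarrow> nat" where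
  "hamming r x y = card {i. i < r \<and> x i \<noteq> y i}"

text \<open>A word of the ball is fixed by the set \<open>D\<close> of coordinates where it leaves
  \<open>c\<close> and by its values there. All subsets are crudely counted by
  \<open>2 ^ r\<close>.\<close>

lemma hamming_ball_card:
  assumes "c \<in> {..<r} \<rightarrow>\<^sub>E {..<q}" and "0 < q"
  shows "card {x \<in> {..<r} \<rightarrow>\<^sub>E {..<q}. hamming r x c \<le> d} \<le> 2 ^ r * q ^ d"
proof -
  let ?W = "\<lambda>D. {..<r} \<rightarrow>\<^sub>E {..<q}"
  let ?I = "{D. D \<subseteq> {..<r} \<and> card D \<le> d}"
  let ?E = "\<lambda>D. PiE {..<r} (\<lambda>i. if i \<in> D then {..<q} else {c i})"
  have fin: "finite ?I" by (rule finite_subset[of _ "Pow {..<r}"]) auto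
  have cardE: "card (?E D) \<le> q ^ d" if "D \<in> ?I" for D
  proof -
    have "card (?E D) = (\<Prod>i<r. if i \<in> D then q else 1)"
      by (subst card_PiE) (auto intro!: prod.cong)
    also have "\<dots> = (\<Prod>i\<in>D. q)"
      using that by (subst prod.inter_restrict[symmetric]) (auto simp: Int_absorb1)
    also have "\<dots> \<le> q ^ d" using that \<open>0 < q\<close> by (simp add: power_increasing)
    finally show ?thesis .
  qed
  have "{x \<in> {..<r} \<rightarrow>\<^sub>E {..<q}. hamming r x c \<le> d} \<subseteq> (\<Union>D\<in>?I. ?E D)"
  proof
    fix x assume x: "x \<in> {x \<in> {..<r} \<rightarrow>\<^sub>E {..<q}. hamming r x c \<le> d}"
    then have "x \<in> ?E {i. i < r \<and> x i \<noteq> c i}" by (auto simp: PiE_iff)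
    moreover have "{i. i < r \<and> x i \<noteq> c i} \<in> ?I" using x by (auto simp: hamming_def)
    ultimately show "x \<in> (\<Union>D\<in>?I. ?E D)" by blast
  qed
  then have "card {x \<in> {..<r} \<rightarrow>\<^sub>E {..<q}. hamming r x c \<le> d} \<le> card (\<Union>D\<in>?I. ?E D)"
    by (rule card_mono[rotated]) (use fin in \<open>auto intro!: finite_PiE\<close>)
  also have "\<dots> \<le> (\<Sum>D\<in>?I. card (?E D))" by (rule card_UN_le[OF fin])
  also have "\<dots> \<le> (\<Sum>D\<in>?I. q ^ d)" by (rule sum_mono[OF cardE])
  also have "\<dots> = card ?I * q ^ d" by simp
  also have "card ?I \<le> card (Pow {..<r})" by (rule card_mono) auto
  then have "card ?I * q ^ d \<le> 2 ^ r * q ^ d" by (simp add: card_Pow)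
  finally show ?thesis .
qed

text \<open>Greedy choice: as long as the balls of radius \<open>d\<close> around the chosen words
  do not cover the space, a word outside all of them can be added.\<close>

lemma gilbert_varshamov:
  assumes "N * (2 ^ r * q ^ d) \<le> q ^ r" and "0 < q"
  shows "\<exists>C. C \<subseteq> {..<r} \<rightarrow>\<^sub>E {..<q} \<and> card C = N \<and> finite C \<and>
             (\<forall>x\<in>C. \<forall>y\<in>C. x \<noteq> y \<longrightarrow> d < hamming r x y)"
  using assms(1)
proof (induction N)
  case 0
  show ?case by (rule exI[of _ "{}"]) auto
next
  case (Suc N)
  let ?W = "{..<r} \<rightarrow>\<^sub>E {..<q}"
  from Suc obtain C where C: "C \<subseteq> ?W" "card C = N" "finite C"
    "\<forall>x\<in>C. \<forall>y\<in>C. x \<noteq> y \<longrightarrow> d < hamming r x y" by auto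
  let ?B = "\<Union>c\<in>C. {x \<in> ?W. hamming r x c \<le> d}"
  have "card ?B \<le> (\<Sum>c\<in>C. card {x \<in> ?W. hamming r x c \<le> d})" by (rule card_UN_le[OF C(3)])
  also have "\<dots> \<le> (\<Sum>c\<in>C. 2 ^ r * q ^ d)"
    using C(1) \<open>0 < q\<close> by (intro sum_mono hamming_ball_card) auto
  also have "\<dots> = N * (2 ^ r * q ^ d)" using C(2) by simp
  also have "\<dots> < q ^ r"
    using Suc.prems \<open>0 < q\<close> by (auto intro: less_le_trans[rotated])
  also have "q ^ r = card ?W" by (subst card_PiE) auto
  finally have "card ?B < card ?W" .
  then have "\<not> ?W \<subseteq> ?B" using C(3)
    by (metis (no_types, lifting) card_mono finite_PiE finite_UN finite_lessThan leD finite_subset mem_Collect_eq subsetI)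
  then obtain z where z: "z \<in> ?W" "z \<notin> ?B" by blast
  have far: "d < hamming r z c" if "c \<in> C" for c using z that by force
  have sym: "hamming r x y = hamming r y x" for x y
    unfolding hamming_def by (rule arg_cong[of _ _ card]) auto
  have "hamming r z z = 0" by (simp add: hamming_def)
  then have "z \<notin> C" using far by force
  then have "card (insert z C) = Suc N" using C by simp
  then show ?case using C z(1) far sym by (intro exI[of _ "insert z C"]) auto
qed


section \<open>The graph without small weak regular partitions\<close>

text \<open>\<open>V\<close> is \<open>{..<n}\<close> so that a vertex is its own source of bits;
  \<open>U\<close> is shifted by \<open>n\<close> only for disjointness. The conclusion is
  contrapositive: few parts on the \<open>U\<close> side force a lower bound on
  \<open>\<epsilon>\<close>.\<close>

lemma hard_graph:
  fixes n r :: nat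
  assumes n: "2 ^ r \<le> n" "n < 2 ^ Suc r" and r: "4 \<le> r"
  obtains w where "weighted_bipartite {n..<2 * n} {..<n} w"
    and "\<And>\<epsilon> P1 P2. real (card P1) \<le> real n / 2 \<Longrightarrow>
           weak_regular_partition \<epsilon> {n..<2 * n} {..<n} w P1 P2 \<Longrightarrow> 1 \<le> 2 ^ 20 * \<epsilon> * sqrt (real r)"
proof -
  let ?U = "{n..<2 * n}" and ?V = "{..<n}"
  \<comment> \<open>Alphabet size 8 leaves room for \<open>n\<close> codewords: in powers of two the
    requirement is \<open>2 * r + 1 + 3 * (r div 4) \<le> 3 * r\<close>, true from
    \<open>r = 4\<close> on.\<close>
  have "n * (2 ^ r * 8 ^ (r div 4)) \<le> 2 ^ Suc r * (2 ^ r * 8 ^ (r div 4))"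
    using n(2) by simp
  also have "\<dots> = (2::nat) ^ (Suc r + r + 3 * (r div 4))"
    by (simp add: power_add power_mult) (simp flip: power_mult_distrib)
  also have "\<dots> \<le> 2 ^ (3 * r)" using r by (intro power_increasing) auto
  also have "\<dots> = 8 ^ r" by (simp add: power_mult)
  finally obtain C where C: "C \<subseteq> {..<r} \<rightarrow>\<^sub>E {..<8}" "card C = n" "finite C"
    "\<forall>x\<in>C. \<forall>y\<in>C. x \<noteq> y \<longrightarrow> r div 4 < hamming r x y"
    using gilbert_varshamov[of n r 8 "r div 4"] by auto
  obtain code where code: "bij_betw code ?U C"
    using C(2,3) finite_same_card_bij[of ?U C] by auto
  \<comment> \<open>Letters 0 to 7 are shifted to lie between -4 and 3; distinct letters stay at
    distance at least 1.\<close>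
  define x where "x u i = real (code u i) - 4" for u i
  have x_le: "\<bar>x u i\<bar> \<le> 4" if "u \<in> ?U" "i < r" for u i
  proof -
    have "code u \<in> {..<r} \<rightarrow>\<^sub>E {..<8}" using code that C(1) bij_betwE by blast
    then have "code u i < 8" using that by auto
    then show ?thesis by (simp add: x_def)
  qed
  have norm_le: "(\<Sum>i<r. (x u i)\<^sup>2) \<le> 16 * real r" if "u \<in> ?U" for u
  proof -
    have "(\<Sum>i<r. (x u i)\<^sup>2) \<le> (\<Sum>i<r. 16)"
    proof (rule sum_mono)
      fix i assume "i \<in> {..<r}"
      then have "\<bar>x u i\<bar> \<le> \<bar>4\<bar>" using x_le that by simp
      then show "(x u i)\<^sup>2 \<le> 16" by (subst (asm) abs_le_square_iff) simp
    qed
    then show ?thesis by simp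
  qed
  have dist_ge: "real r / 4 \<le> (\<Sum>i<r. (x u i - x u' i)\<^sup>2)"
    if "u \<in> ?U" "u' \<in> ?U" "u \<noteq> u'" for u u'
  proof -
    have "code u \<noteq> code u'" "code u \<in> C" "code u' \<in> C"
      using code that by (auto simp: bij_betw_def inj_on_def)
    then have "r div 4 < hamming r (code u) (code u')" using C(4) by blast
    \<comment> \<open>The strict inequality between integers makes up for the rounding in
      \<open>r div 4\<close>.\<close>
    then have "real r / 4 \<le> real (hamming r (code u) (code u'))" by linarith
    also have "\<dots> = (\<Sum>i\<in>{i. i < r \<and> code u i \<noteq> code u' i}. 1)" by (simp add: hamming_def)
    also have "\<dots> \<le> (\<Sum>i\<in>{i. i < r \<and> code u i \<noteq> code u' i}. (x u i - x u' i)\<^sup>2)"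
    proof (rule sum_mono)
      fix i assume "i \<in> {i. i < r \<and> code u i \<noteq> code u' i}"
      then have "\<bar>1\<bar> \<le> \<bar>x u i - x u' i\<bar>" by (auto simp: x_def)
      then show "1 \<le> (x u i - x u' i)\<^sup>2" by (subst (asm) abs_le_square_iff) simp
    qed
    also have "\<dots> \<le> (\<Sum>i<r. (x u i - x u' i)\<^sup>2)"
      by (rule sum_mono2) auto
    finally show ?thesis .
  qed
  \<comment> \<open>Small enough that the fourth moment loss, at most 48 r / 512, stays below r / 8,
    half of the squared distance r / 4.\<close>
  define \<alpha> where "\<alpha> = 1 / (2 ^ 9 * sqrt (real r))"
  have \<alpha>: "0 < \<alpha>" "\<alpha>\<^sup>2 * real r = 1 / 2 ^ 18" "\<alpha> * real r = sqrt (real r) / 2 ^ 9"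
    using r by (simp_all add: \<alpha>_def power_mult_distrib power_divide real_div_sqrt divide_simps)
  define s where "s u = sign_sum r (x u)" for u
  define w where "w u v = clip (\<alpha> * s u v)" for u v
  have corr: "real n * sqrt (real r) / 2 ^ 13 \<le> (\<Sum>v<n. (s u v - s u' v) * (w u v - w u' v))"
    if u: "u \<in> ?U" "u' \<in> ?U" "u \<noteq> u'" for u u'
  proof -
    let ?D = "(\<Sum>i<r. (x u i - x u' i)\<^sup>2)"
    let ?N = "\<lambda>u. (\<Sum>i<r. (x u i)\<^sup>2)"
    \<comment> \<open>Exactly one full period fits into \<open>n\<close>, and it covers more than
      half of it.\<close>
    have "n < 2 * (n div 2 ^ r * 2 ^ r)"
    proof -
      have "n div 2 ^ r = 1"
        using n by (intro div_nat_eqI) auto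
      then show ?thesis using n by simp
    qed
    then have n2: "real n / 2 \<le> real (n div 2 ^ r) * 2 ^ r"
    proof -
      have "real n < real (2 * (n div 2 ^ r * 2 ^ r))"
        using \<open>n < 2 * (n div 2 ^ r * 2 ^ r)\<close> by (simp only: of_nat_less_iff)
      then show ?thesis by simp
    qed
    have "\<alpha>\<^sup>2 * ((?N u)\<^sup>2 + (?N u')\<^sup>2) \<le> \<alpha>\<^sup>2 * ((16 * real r)\<^sup>2 + (16 * real r)\<^sup>2)"
      using norm_le u by (intro mult_left_mono add_mono power_mono sum_nonneg) auto
    also have "\<dots> = 512 * (\<alpha>\<^sup>2 * real r) * real r"
      by (simp add: power2_eq_square)
    also have "\<dots> = real r / 512" by (simp add: \<alpha>(2))
    finally have "48 * (\<alpha>\<^sup>2 * ((?N u)\<^sup>2 + (?N u')\<^sup>2)) \<le> 48 * (real r / 512)"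
      by (rule mult_left_mono) simp
    then have "48 * \<alpha>\<^sup>2 * ((?N u)\<^sup>2 + (?N u')\<^sup>2) \<le> real r / 8"
      unfolding mult.assoc by (rule order.trans) simp
    then have "real r / 8 \<le> ?D - 48 * \<alpha>\<^sup>2 * ((?N u)\<^sup>2 + (?N u')\<^sup>2)"
      using dist_ge[OF u] by simp
    then have "real n / 2 * (\<alpha> * (real r / 8))
        \<le> real (n div 2 ^ r) * 2 ^ r * (\<alpha> * (?D - 48 * \<alpha>\<^sup>2 * ((?N u)\<^sup>2 + (?N u')\<^sup>2)))"
      using \<alpha>(1) by (intro mult_mono n2) auto
    also have "\<dots> \<le> (\<Sum>v<n. (s u v - s u' v) * (w u v - w u' v))"
      unfolding s_def w_def by (rule clip_sign_sum_correlation_ge[OF \<alpha>(1)])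
    finally show ?thesis using \<alpha>(3) by (simp add: mult.assoc)
  qed
  \<comment> \<open>The bound of \<open>corr\<close> divided by 8, the largest possible
    \<open>\<bar>x u i - x u' i\<bar>\<close>.\<close>
  define \<beta> where "\<beta> = real n * sqrt (real r) / 2 ^ 16"
  have "1 \<le> 2 ^ 20 * \<epsilon> * sqrt (real r)"
    if P1n: "real (card P1) \<le> real n / 2" and reg: "weak_regular_partition \<epsilon> ?U ?V w P1 P2"
    for \<epsilon> P1 P2
  proof -
    have P1: "partition_on ?U P1" and P2: "partition_on ?V P2"
      using reg by (auto simp: weak_regular_partition_def)
    obtain p where p: "\<And>u. u \<in> ?U \<Longrightarrow> p u \<in> P1 \<and> u \<in> p u"
      using partition_on_part_function[OF P1] by blast
    obtain q where q: "\<And>v. v \<in> ?V \<Longrightarrow> q v \<in> P2 \<and> v \<in> q v"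
      using partition_on_part_function[OF P2] by blast
    define F where "F i u = (\<Sum>v<n. bit_sign v i * (w u v - density w (p u) (q v)))" for i u
    define l where "l u = (\<Sum>i<r. \<bar>F i u\<bar>)" for u
    have upper: "(\<Sum>u\<in>?U. \<bar>F i u\<bar>) \<le> 4 * \<epsilon> * (real n)\<^sup>2" for i
      unfolding F_def using weak_regular_signed_sum_le[OF reg _ _ p q, of "\<lambda>v. bit_sign v i"]
      by (simp add: bit_sign_def)
    have pair: "\<beta> \<le> l u + l u'"
      if u: "u \<in> ?U" "u' \<in> ?U" "u \<noteq> u'" and same: "p u = p u'" for u u'
    proof -
      have F_diff: "F i u - F i u' = (\<Sum>v<n. bit_sign v i * (w u v - w u' v))" for i
        by (simp add: F_def same algebra_simps flip: sum_subtractf)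
      have "(\<Sum>v<n. (s u v - s u' v) * (w u v - w u' v))
          = (\<Sum>v<n. \<Sum>i<r. (x u i - x u' i) * (bit_sign v i * (w u v - w u' v)))"
      proof (rule sum.cong[OF refl])
        fix v
        have "s u v - s u' v = (\<Sum>i<r. (x u i - x u' i) * bit_sign v i)"
          by (simp add: s_def sign_sum_def sum_subtractf left_diff_distrib)
        then show "(s u v - s u' v) * (w u v - w u' v)
            = (\<Sum>i<r. (x u i - x u' i) * (bit_sign v i * (w u v - w u' v)))"
          by (simp add: sum_distrib_right mult.assoc)
      qed
      also have "\<dots> = (\<Sum>i<r. (x u i - x u' i) * (F i u - F i u'))"
        unfolding F_diff sum_distrib_left by (rule sum.swap)
      also have "\<dots> \<le> (\<Sum>i<r. 8 * (\<bar>F i u\<bar> + \<bar>F i u'\<bar>))"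
      proof (rule sum_mono)
        fix i assume i: "i \<in> {..<r}"
        have "(x u i - x u' i) * (F i u - F i u') \<le> \<bar>x u i - x u' i\<bar> * \<bar>F i u - F i u'\<bar>"
          by (metis abs_ge_self abs_mult)
        also have "\<dots> \<le> 8 * (\<bar>F i u\<bar> + \<bar>F i u'\<bar>)"
          using x_le[of u i] x_le[of u' i] u i by (intro mult_mono) auto
        finally show "(x u i - x u' i) * (F i u - F i u') \<le> 8 * (\<bar>F i u\<bar> + \<bar>F i u'\<bar>)" .
      qed
      also have "\<dots> = 8 * (l u + l u')"
        by (simp add: l_def sum.distrib flip: sum_distrib_left)
      finally show ?thesis using corr[OF u] by (simp add: \<beta>_def)
    qed
    \<comment> \<open>By \<open>pair\<close>, two members of \<open>S\<close> cannot share a part,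
      so \<open>S\<close> has at most as many elements as \<open>P1\<close>.\<close>
    define S where "S = {u\<in>?U. l u < \<beta> / 2}"
    have "inj_on p S"
    proof (rule inj_onI, rule ccontr)
      fix u u' assume "u \<in> S" "u' \<in> S" "p u = p u'" "u \<noteq> u'"
      then show False using pair[of u u'] by (auto simp: S_def)
    qed
    moreover have "p ` S \<subseteq> P1" using p by (auto simp: S_def)
    moreover have "finite P1" using P1 by (rule finite_elements[rotated]) simp
    ultimately have "card S \<le> card P1" by (metis card_inj_on_le)
    moreover have "card (?U - S) = card ?U - card S"
      by (rule card_Diff_subset) (auto simp: S_def)
    ultimately have many: "real n / 2 \<le> real (card (?U - S))" using P1n by simp
    have "\<beta> \<ge> 0" by (simp add: \<beta>_def)
    \<comment> \<open>The sum of all \<open>\<bar>F i u\<bar>\<close> is bounded below vertex by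
      vertex, and above coordinate by coordinate through \<open>upper\<close>.\<close>
    have "real n / 2 * (\<beta> / 2) \<le> real (card (?U - S)) * (\<beta> / 2)"
      using many \<open>\<beta> \<ge> 0\<close> by (intro mult_right_mono) auto
    also have "\<dots> = (\<Sum>u\<in>?U - S. \<beta> / 2)" by simp
    also have "\<dots> \<le> (\<Sum>u\<in>?U - S. l u)" by (rule sum_mono) (auto simp: S_def)
    also have "\<dots> \<le> (\<Sum>u\<in>?U. l u)" by (rule sum_mono2) (auto simp: l_def sum_nonneg)
    also have "\<dots> = (\<Sum>i<r. \<Sum>u\<in>?U. \<bar>F i u\<bar>)" unfolding l_def by (rule sum.swap)
    also have "\<dots> \<le> (\<Sum>i<r. 4 * \<epsilon> * (real n)\<^sup>2)" by (rule sum_mono[OF upper])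
    also have "\<dots> = 4 * \<epsilon> * (real n)\<^sup>2 * (sqrt (real r) * sqrt (real r))" by simp
    also have "\<dots> = ((real n)\<^sup>2 * sqrt (real r)) * (2 ^ 20 * \<epsilon> * sqrt (real r)) / 2 ^ 18"
      by (simp only: mult_ac) simp
    also have "real n / 2 * (\<beta> / 2) = ((real n)\<^sup>2 * sqrt (real r)) * 1 / 2 ^ 18"
      by (simp add: \<beta>_def power2_eq_square)
    finally have "((real n)\<^sup>2 * sqrt (real r)) * 1
        \<le> ((real n)\<^sup>2 * sqrt (real r)) * (2 ^ 20 * \<epsilon> * sqrt (real r))"
      by (subst (asm) divide_le_cancel) simp
    moreover have "0 < (real n)\<^sup>2 * sqrt (real r)"
    proof -
      have "0 < n" using n(1) by (simp add: less_le_trans[of 0 "2 ^ r"])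
      then show ?thesis using r by simp
    qed
    ultimately show ?thesis by (simp only: mult_le_cancel_left_pos)
  qed
  moreover have "weighted_bipartite ?U ?V w"
    by (auto simp: weighted_bipartite_def w_def clip_bounds)
  ultimately show ?thesis using that by blast
qed


section \<open>The Frieze-Kannan weak regularity lemma by energy increment\<close>

text \<open>Expanding around the mean, the linear term sums to zero and the dropped term is a
  square.\<close>

lemma sum_sq_dev_mean_le:
  fixes f :: "'a \<Rightarrow> real"
  assumes "finite A"
  shows "(\<Sum>a\<in>A. (f a - sum f A / real (card A))\<^sup>2) \<le> (\<Sum>a\<in>A. (f a - c)\<^sup>2)"
proof (cases "A = {}")
  case False
  define \<mu> where "\<mu> = sum f A / real (card A)"
  have "(\<Sum>a\<in>A. f a - \<mu>) = 0"
    using assms False by (simp add: sum_subtractf \<mu>_def)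
  then have "(\<Sum>a\<in>A. (f a - \<mu>)\<^sup>2 + 2 * (\<mu> - c) * (f a - \<mu>)) = (\<Sum>a\<in>A. (f a - \<mu>)\<^sup>2)"
    by (simp add: sum.distrib flip: sum_distrib_left)
  moreover have "(\<Sum>a\<in>A. (f a - \<mu>)\<^sup>2 + 2 * (\<mu> - c) * (f a - \<mu>)) \<le> (\<Sum>a\<in>A. (f a - c)\<^sup>2)"
  proof (rule sum_mono)
    fix a
    have "(f a - c)\<^sup>2 = (f a - \<mu>)\<^sup>2 + 2 * (\<mu> - c) * (f a - \<mu>) + (\<mu> - c)\<^sup>2"
      by (simp add: power2_eq_square algebra_simps)
    then show "(f a - \<mu>)\<^sup>2 + 2 * (\<mu> - c) * (f a - \<mu>) \<le> (f a - c)\<^sup>2" by simp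
  qed
  ultimately show ?thesis by (simp add: \<mu>_def)
qed simp

text \<open>Partitions are carried as colourings by natural numbers, so that refinement becomes
  arithmetic on colours. In \<open>fibres\<close> only colours in use occur, since
  \<open>partition_on\<close> excludes empty parts.\<close>

definition fibre :: "'a set \<Rightarrow> ('a \<Rightarrow> nat) \<Rightarrow> nat \<Rightarrow> 'a set" where
  "fibre U a c = {u\<in>U. a u = c}"

definition fibres :: "'a set \<Rightarrow> ('a \<Rightarrow> nat) \<Rightarrow> 'a set set" where
  "fibres U a = fibre U a ` a ` U"

lemma partition_on_fibres: "partition_on U (fibres U a)"
  by (rule partition_onI) (auto simp: fibres_def fibre_def disjnt_def)

text \<open>On each product of two colour classes the density is the mean of \<open>w\<close>, hence
  the best constant approximation in least squares.\<close>

lemma sum_sq_dev_density_le: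
  assumes fin: "finite U" "finite V"
  shows "(\<Sum>u\<in>U. \<Sum>v\<in>V. (w u v - density w (fibre U a (a u)) (fibre V b (b v)))\<^sup>2)
       \<le> (\<Sum>u\<in>U. \<Sum>v\<in>V. (w u v - G (a u) (b v))\<^sup>2)"
proof -
  define \<delta> where "\<delta> c d = density w (fibre U a c) (fibre V b d)" for c d
  have split: "(\<Sum>u\<in>U. \<Sum>v\<in>V. f u v)
      = (\<Sum>(c, d)\<in>a ` U \<times> b ` V. \<Sum>(u, v)\<in>fibre U a c \<times> fibre V b d. f u v)"
    for f :: "'a \<Rightarrow> 'a \<Rightarrow> real"
  proof -
    have "(\<Sum>u\<in>U. \<Sum>v\<in>V. f u v) = (\<Sum>z\<in>U \<times> V. case_prod f z)"
      by (simp add: sum.cartesian_product)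
    also have "\<dots> = (\<Sum>y\<in>a ` U \<times> b ` V.
        \<Sum>z\<in>{z\<in>U \<times> V. map_prod a b z = y}. case_prod f z)"
      by (rule sum.group[symmetric]) (use fin in auto)
    also have "\<dots> = (\<Sum>(c, d)\<in>a ` U \<times> b ` V. \<Sum>(u, v)\<in>fibre U a c \<times> fibre V b d. f u v)"
      by (intro sum.cong refl) (auto simp: fibre_def intro!: sum.cong)
    finally show ?thesis .
  qed
  have "(\<Sum>u\<in>U. \<Sum>v\<in>V. (w u v - \<delta> (a u) (b v))\<^sup>2)
      = (\<Sum>(c, d)\<in>a ` U \<times> b ` V. \<Sum>(u, v)\<in>fibre U a c \<times> fibre V b d. (w u v - \<delta> c d)\<^sup>2)"
    unfolding split by (intro sum.cong refl) (auto simp: fibre_def intro!: sum.cong)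
  also have "\<dots> \<le> (\<Sum>(c, d)\<in>a ` U \<times> b ` V. \<Sum>(u, v)\<in>fibre U a c \<times> fibre V b d. (w u v - G c d)\<^sup>2)"
  proof (intro sum_mono, clarify)
    fix c d
    have "\<delta> c d = sum (case_prod w) (fibre U a c \<times> fibre V b d)
        / real (card (fibre U a c \<times> fibre V b d))"
      by (simp add: \<delta>_def density_def edge_weight_def sum.cartesian_product card_cartesian_product)
    moreover have "finite (fibre U a c \<times> fibre V b d)" using fin by (simp add: fibre_def)
    ultimately show "(\<Sum>(u, v)\<in>fibre U a c \<times> fibre V b d. (w u v - \<delta> c d)\<^sup>2)
        \<le> (\<Sum>(u, v)\<in>fibre U a c \<times> fibre V b d. (w u v - G c d)\<^sup>2)"
      using sum_sq_dev_mean_le[of "fibre U a c \<times> fibre V b d" "case_prod w" "G c d"]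
      by (simp add: case_prod_unfold)
  qed
  also have "\<dots> = (\<Sum>u\<in>U. \<Sum>v\<in>V. (w u v - G (a u) (b v))\<^sup>2)"
    unfolding split by (intro sum.cong refl) (auto simp: fibre_def intro!: sum.cong)
  finally show ?thesis by (simp add: \<delta>_def)
qed

definition split_colour :: "'a set \<Rightarrow> ('a \<Rightarrow> nat) \<Rightarrow> 'a \<Rightarrow> nat" where
  "split_colour A a u = 2 * a u + of_bool (u \<in> A)"

lemma split_colour_simps:
  "split_colour A a u div 2 = a u" "odd (split_colour A a u) \<longleftrightarrow> u \<in> A"
  by (auto simp: split_colour_def)

lemma card_split_colour_image:
  assumes "finite U"
  shows "card (split_colour A a ` U) \<le> 2 * card (a ` U)"
proof -
  have "split_colour A a ` U \<subseteq> (\<lambda>(c, e). 2 * c + e) ` (a ` U \<times> {0, 1})"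
    by (force simp: split_colour_def)
  then have "card (split_colour A a ` U) \<le> card ((\<lambda>(c, e). 2 * c + e) ` (a ` U \<times> {0, 1::nat}))"
    by (rule card_mono[rotated]) (use assms in auto)
  also have "\<dots> \<le> card (a ` U \<times> {0, 1::nat})"
    by (rule card_image_le) (use assms in auto)
  finally show ?thesis by (simp add: card_cartesian_product)
qed

text \<open>Sets \<open>A\<close>, \<open>B\<close> violating regularity show how to improve:
  passing from \<open>G\<close> to the densities costs nothing, and adding a constant
  \<open>c\<close> on \<open>A\<close> times \<open>B\<close> then lowers the squared error. The new
  function depends only on the colours refined by \<open>A\<close> and \<open>B\<close>.\<close>

lemma energy_decrement:
  assumes fin: "finite U" "finite V" and n: "card U = n" "card V = n" "0 < n" and \<epsilon>: "0 < \<epsilon>"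
    and irr: "\<not> weak_regular_partition \<epsilon> U V w (fibres U a) (fibres V b)"
  obtains A B G' where
    "(\<Sum>u\<in>U. \<Sum>v\<in>V. (w u v - G' (split_colour A a u) (split_colour B b v))\<^sup>2)
       \<le> (\<Sum>u\<in>U. \<Sum>v\<in>V. (w u v - G (a u) (b v))\<^sup>2) - \<epsilon>\<^sup>2 * (real n)\<^sup>2"
proof -
  define \<delta> where "\<delta> c d = density w (fibre U a c) (fibre V b d)" for c d
  obtain A B where AB: "A \<subseteq> U" "B \<subseteq> V"
    and big: "\<epsilon> * (real n)\<^sup>2 < \<bar>discrepancy w (fibres U a) (fibres V b) A B\<bar>"
    using irr n(1) partition_on_fibres[of U a] partition_on_fibres[of V b]
    by (auto simp: weak_regular_partition_def not_le)
  define D where "D = discrepancy w (fibres U a) (fibres V b) A B"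
  have D: "D = (\<Sum>u\<in>A. \<Sum>v\<in>B. w u v - \<delta> (a u) (b v))"
    unfolding D_def \<delta>_def
    by (rule discrepancy_eq_sum[OF partition_on_fibres partition_on_fibres fin AB])
      (auto simp: fibres_def fibre_def)
  \<comment> \<open>This maximises \<open>2 * c * D - c\<^sup>2 * (real n)\<^sup>2\<close>, a lower
    bound for the gain, with value \<open>D\<^sup>2 / (real n)\<^sup>2\<close>.\<close>
  define c where "c = D / (real n)\<^sup>2"
  define G' where "G' x y = \<delta> (x div 2) (y div 2) + (if odd x \<and> odd y then c else 0)" for x y
  have inter: "{u\<in>U. u \<in> A} = A" "{v\<in>V. v \<in> B} = B" using AB by auto
  have restrict: "(\<Sum>u\<in>U. \<Sum>v\<in>V. of_bool (u \<in> A) * of_bool (v \<in> B) * f u v)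
      = (\<Sum>u\<in>A. \<Sum>v\<in>B. f u v)" for f :: "'a \<Rightarrow> 'a \<Rightarrow> real"
  proof -
    have "(\<Sum>u\<in>U. \<Sum>v\<in>V. of_bool (u \<in> A) * of_bool (v \<in> B) * f u v)
        = (\<Sum>u\<in>U. if u \<in> A then \<Sum>v\<in>V. if v \<in> B then f u v else 0 else 0)"
      by (intro sum.cong refl) (auto intro!: sum.cong)
    then show ?thesis
      by (simp add: inter fin flip: sum.inter_filter)
  qed
  have "(\<Sum>u\<in>U. \<Sum>v\<in>V. (w u v - G' (split_colour A a u) (split_colour B b v))\<^sup>2)
      = (\<Sum>u\<in>U. \<Sum>v\<in>V. (w u v - \<delta> (a u) (b v))\<^sup>2
          - of_bool (u \<in> A) * of_bool (v \<in> B) * (2 * c * (w u v - \<delta> (a u) (b v)) - c\<^sup>2))"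
    by (intro sum.cong refl)
      (simp add: G'_def split_colour_simps power2_eq_square algebra_simps)
  also have "\<dots> = (\<Sum>u\<in>U. \<Sum>v\<in>V. (w u v - \<delta> (a u) (b v))\<^sup>2)
      - (\<Sum>u\<in>A. \<Sum>v\<in>B. 2 * c * (w u v - \<delta> (a u) (b v)) - c\<^sup>2)"
    by (simp only: sum_subtractf restrict)
  also have "(\<Sum>u\<in>A. \<Sum>v\<in>B. 2 * c * (w u v - \<delta> (a u) (b v)) - c\<^sup>2)
      = 2 * c * D - c\<^sup>2 * (real (card A) * real (card B))"
    by (simp add: D sum_subtractf sum_distrib_left right_diff_distrib)
  finally have eq: "(\<Sum>u\<in>U. \<Sum>v\<in>V. (w u v - G' (split_colour A a u) (split_colour B b v))\<^sup>2)
      = (\<Sum>u\<in>U. \<Sum>v\<in>V. (w u v - \<delta> (a u) (b v))\<^sup>2)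
        - (2 * c * D - c\<^sup>2 * (real (card A) * real (card B)))" .
  moreover have "(\<Sum>u\<in>U. \<Sum>v\<in>V. (w u v - \<delta> (a u) (b v))\<^sup>2)
      \<le> (\<Sum>u\<in>U. \<Sum>v\<in>V. (w u v - G (a u) (b v))\<^sup>2)"
    unfolding \<delta>_def by (rule sum_sq_dev_density_le[OF fin])
  moreover have "\<epsilon>\<^sup>2 * (real n)\<^sup>2 \<le> 2 * c * D - c\<^sup>2 * (real (card A) * real (card B))"
  proof -
    have "real (card A) * real (card B) \<le> real n * real n"
      using AB n card_mono[OF fin(1) AB(1)] card_mono[OF fin(2) AB(2)] by (intro mult_mono) auto
    then have "c\<^sup>2 * (real (card A) * real (card B)) \<le> c\<^sup>2 * (real n)\<^sup>2"
      by (intro mult_left_mono) (auto simp: power2_eq_square)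
    also have "c\<^sup>2 * (real n)\<^sup>2 = D\<^sup>2 / (real n)\<^sup>2"
      using n(3) by (simp add: c_def power2_eq_square)
    finally have "D\<^sup>2 / (real n)\<^sup>2 \<le> 2 * c * D - c\<^sup>2 * (real (card A) * real (card B))"
      by (simp add: c_def power2_eq_square)
    moreover have "(\<epsilon> * (real n)\<^sup>2)\<^sup>2 \<le> D\<^sup>2"
      using big \<epsilon> by (intro abs_le_square_iff[THEN iffD1]) (auto simp: D_def)
    then have "\<epsilon>\<^sup>2 * (real n)\<^sup>2 \<le> D\<^sup>2 / (real n)\<^sup>2"
      using n(3) by (simp add: field_simps power2_eq_square)
    ultimately show ?thesis by linarith
  qed
  ultimately show ?thesis using that[of G' A B] unfolding eq by linarith
qed

text \<open>Starts from the zero function, whose error is at most \<open>n\<close> squared as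
  weights are at most 1. While at most \<open>2 ^ m\<close> colours are in use, \<open>none\<close>
  supplies irregularity, and each step doubles the colours at most.\<close>

lemma energy_iteration:
  assumes G: "weighted_bipartite U V w" and n: "card U = n" "card V = n" "0 < n" and \<epsilon>: "0 < \<epsilon>"
    and none: "\<And>P1 P2. card P1 \<le> 2 ^ m \<Longrightarrow> card P2 \<le> 2 ^ m \<Longrightarrow>
                 \<not> weak_regular_partition \<epsilon> U V w P1 P2"
  shows "j \<le> m \<Longrightarrow> \<exists>(a :: 'a \<Rightarrow> nat) (b :: 'a \<Rightarrow> nat) G. card (a ` U) \<le> 2 ^ j \<and> card (b ` V) \<le> 2 ^ j \<and>
    (\<Sum>u\<in>U. \<Sum>v\<in>V. (w u v - G (a u) (b v))\<^sup>2) \<le> (1 - real j * \<epsilon>\<^sup>2) * (real n)\<^sup>2"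
proof (induction j)
  case 0
  have "(\<Sum>u\<in>U. \<Sum>v\<in>V. (w u v - 0)\<^sup>2) \<le> (\<Sum>u\<in>U. \<Sum>v\<in>V. 1)"
    using G by (intro sum_mono) (auto simp: weighted_bipartite_def power_le_one)
  also have "\<dots> = (real n)\<^sup>2" using n by (simp add: power2_eq_square)
  finally have "(\<Sum>u\<in>U. \<Sum>v\<in>V. (w u v - 0)\<^sup>2) \<le> (1 - real 0 * \<epsilon>\<^sup>2) * (real n)\<^sup>2"
    by simp
  moreover have "card ((\<lambda>_. 0 :: nat) ` W) \<le> 2 ^ 0" for W :: "'a set"
    by (simp add: image_constant_conv)
  ultimately show ?case
    by (intro exI[of _ "\<lambda>_. 0"] exI[of _ "\<lambda>_ _. 0"] conjI)
next
  case (Suc j)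
  then obtain a :: "'a \<Rightarrow> nat" and b :: "'a \<Rightarrow> nat" and G where
    ab: "card (a ` U) \<le> 2 ^ j" "card (b ` V) \<le> 2 ^ j"
    and err: "(\<Sum>u\<in>U. \<Sum>v\<in>V. (w u v - G (a u) (b v))\<^sup>2) \<le> (1 - real j * \<epsilon>\<^sup>2) * (real n)\<^sup>2"
    using Suc_leD by blast
  have fin: "finite U" "finite V" using G by (auto simp: weighted_bipartite_def)
  have pow: "(2::nat) ^ j \<le> 2 ^ m" using Suc.prems by (intro power_increasing) auto
  have "card (fibres U a) \<le> card (a ` U)" "card (fibres V b) \<le> card (b ` V)"
    unfolding fibres_def using fin by (auto intro!: card_image_le)
  with ab pow have "card (fibres U a) \<le> 2 ^ m" "card (fibres V b) \<le> 2 ^ m"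
    by linarith+
  then obtain A B G' where
    "(\<Sum>u\<in>U. \<Sum>v\<in>V. (w u v - G' (split_colour A a u) (split_colour B b v))\<^sup>2)
       \<le> (\<Sum>u\<in>U. \<Sum>v\<in>V. (w u v - G (a u) (b v))\<^sup>2) - \<epsilon>\<^sup>2 * (real n)\<^sup>2"
    by (rule energy_decrement[OF fin n \<epsilon> none])
  with err have "(\<Sum>u\<in>U. \<Sum>v\<in>V. (w u v - G' (split_colour A a u) (split_colour B b v))\<^sup>2)
       \<le> (1 - real (Suc j) * \<epsilon>\<^sup>2) * (real n)\<^sup>2"
    by (simp add: algebra_simps)
  moreover have "card (split_colour A a ` U) \<le> 2 ^ Suc j" "card (split_colour B b ` V) \<le> 2 ^ Suc j"
    using ab card_split_colour_image[OF fin(1), of A a] card_split_colour_image[OF fin(2), of B b]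
    by auto
  ultimately show ?case by blast
qed

lemma weak_regularity:
  fixes \<epsilon> :: real
  assumes \<epsilon>: "0 < \<epsilon>"
  shows "\<exists>k. \<forall>(U :: 'a set) V w. weighted_bipartite U V w \<and> card U = card V \<longrightarrow>
     (\<exists>P1 P2. card P1 \<le> k \<and> card P2 \<le> k \<and> weak_regular_partition \<epsilon> U V w P1 P2)"
proof -
  \<comment> \<open>After \<open>m\<close> decrements the squared error would be negative, so
    \<open>2 ^ m\<close> parts suffice.\<close>
  obtain m :: nat where m: "1 / \<epsilon>\<^sup>2 < real m" using reals_Archimedean2 by blast
  have "\<exists>P1 P2. card P1 \<le> 2 ^ m \<and> card P2 \<le> 2 ^ m \<and> weak_regular_partition \<epsilon> U V w P1 P2"
    if G: "weighted_bipartite U V w" and eq: "card U = card V" for U V :: "'a set" and w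
  proof (cases "card U = 0")
    case True
    then have "U = {}" "V = {}" using G eq by (auto simp: weighted_bipartite_def)
    then show ?thesis
      by (intro exI[of _ "{}"])
        (auto simp: weak_regular_partition_def discrepancy_def edge_weight_def partition_on_def)
  next
    case False
    show ?thesis
    proof (rule ccontr)
      assume "\<not> ?thesis"
      then obtain a :: "'a \<Rightarrow> nat" and b :: "'a \<Rightarrow> nat" and G where
        "(\<Sum>u\<in>U. \<Sum>v\<in>V. (w u v - G (a u) (b v))\<^sup>2) \<le> (1 - real m * \<epsilon>\<^sup>2) * (real (card U))\<^sup>2"
        using energy_iteration[OF G refl eq[symmetric] _ \<epsilon>, of m m] False by auto
      moreover have "0 \<le> (\<Sum>u\<in>U. \<Sum>v\<in>V. (w u v - G (a u) (b v))\<^sup>2)"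
        by (intro sum_nonneg) auto
      moreover have "(1 - real m * \<epsilon>\<^sup>2) * (real (card U))\<^sup>2 < 0"
        using m \<epsilon> False by (intro mult_neg_pos) (auto simp: field_simps)
      ultimately show False by linarith
    qed
  qed
  then show ?thesis by blast
qed

section \<open>Choice of parameters and the bound on \<open>k0\<close>\<close>

theorem theorem7p12:
  fixes \<epsilon> :: real and n :: nat
  assumes "0 < \<epsilon>" and "\<epsilon> \<le> 2 powi (-50)"
    and "n = nat (round (2 powr (2 powi (-45) * \<epsilon> powi (-2)) :: real))"
  shows "(\<exists>(U :: nat set) V w. weighted_bipartite U V w \<and> card U = n \<and> card V = n \<and>
            \<not> (\<exists>P1 P2. real (card P1) \<le> real n / 2 \<and> weak_regular_partition \<epsilon> U V w P1 P2))
         \<and> real (k0 \<epsilon>) > 2 powr (2 powi (-46) * \<epsilon> powi (-2))"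
proof -
  define L :: real where "L = 2 powi (-45) * \<epsilon> powi (-2)"
  have \<epsilon>L: "\<epsilon>\<^sup>2 * L = 1 / 2 ^ 45"
    using assms(1) by (simp add: L_def power_int_minus field_simps)
  have half: "2 powi (-46) * \<epsilon> powi (-2) = L / 2"
    by (simp add: L_def power_int_minus)
  have L_ge: "6 \<le> L"
  proof -
    have "\<epsilon>\<^sup>2 \<le> (1 / 2 ^ 50)\<^sup>2"
      using assms by (intro power_mono) (auto simp: power_int_minus field_simps)
    then have "\<epsilon>\<^sup>2 * 6 \<le> \<epsilon>\<^sup>2 * L" unfolding \<epsilon>L by (simp add: power2_eq_square)
    then show ?thesis using assms(1) by simp
  qed
  \<comment> \<open>The bound claimed for \<open>k0\<close>. As \<open>n\<close> is
    \<open>y * y\<close> rounded and \<open>y \<ge> 8\<close>, the rounding error is harmless and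
    \<open>n / 2\<close> is at least \<open>y\<close>.\<close>
  define y where "y = 2 powr (L / 2)"
  have y_sq: "2 powr L = y * y" by (simp add: y_def flip: powr_add)
  have "2 powr 3 \<le> y" using L_ge unfolding y_def by (intro powr_mono) auto
  then have y: "8 \<le> y" by simp
  have "2 * y * 4 \<le> y * y" using y by (simp add: mult_right_mono)
  have "round (2 powr L) \<ge> 0" by (simp add: round_def)
  then have "real n = of_int (round (2 powr L))" using assms(3) by (simp add: L_def)
  then have n_bd: "\<bar>real n - 2 powr L\<bar> \<le> 1 / 2"
    using of_int_round_abs_le[of "2 powr L"] by simp
  have n_ge: "2 * y \<le> real n" and n16: "16 \<le> n"
    using n_bd y_sq \<open>2 * y * 4 \<le> y * y\<close> y by linarith+
  obtain r where r: "2 ^ r \<le> n" "n < 2 ^ Suc r"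
    using ex_power_ivl1[of 2 n] n16 by auto
  have "(2::nat) ^ 4 < 2 ^ Suc r" using n16 r(2) by simp
  then have r4: "4 \<le> r" by (simp only: power_strict_increasing_iff)
  have r_le: "real r \<le> 2 * L"
  proof -
    have "2 powr real r = real (2 ^ r)" by (simp add: powr_realpow)
    also have "\<dots> \<le> real n" using r(1) by (simp only: of_nat_le_iff)
    also have "\<dots> \<le> 2 * 2 powr L" using n_bd y_sq \<open>2 * y * 4 \<le> y * y\<close> y by linarith
    also have "\<dots> = 2 powr (L + 1)" by (simp add: powr_add)
    finally show ?thesis using L_ge by simp
  qed
  \<comment> \<open>Squared, the left side is at most 2^40 * 2 / 2^45 = 1/16, contradicting the
    conclusion of \<open>hard_graph\<close>.\<close>
  have small: "2 ^ 20 * \<epsilon> * sqrt (real r) < 1"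
  proof -
    have "(2 ^ 20 * \<epsilon> * sqrt (real r))\<^sup>2 = 2 ^ 40 * (\<epsilon>\<^sup>2 * real r)"
      by (simp add: power_mult_distrib)
    also have "\<dots> \<le> 2 ^ 40 * (\<epsilon>\<^sup>2 * (2 * L))"
      using r_le by (intro mult_left_mono) auto
    also have "\<dots> < 1\<^sup>2" using \<epsilon>L by simp
    finally show ?thesis by (rule power_less_imp_less_base) simp
  qed
  obtain w where w: "weighted_bipartite {n..<2 * n} {..<n} w"
    and irr: "\<And>P1 P2. real (card P1) \<le> real n / 2 \<Longrightarrow>
      \<not> weak_regular_partition \<epsilon> {n..<2 * n} {..<n} w P1 P2"
    using hard_graph[OF r r4] small by (metis linorder_not_le)
  \<comment> \<open>\<open>LEAST\<close> has its defining property only if some \<open>k\<close> has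
    it; \<open>weak_regularity\<close> provides one.\<close>
  have "\<forall>(U :: nat set) V w. weighted_bipartite U V w \<and> card U = card V \<longrightarrow>
     (\<exists>P1 P2. card P1 \<le> k0 \<epsilon> \<and> card P2 \<le> k0 \<epsilon> \<and> weak_regular_partition \<epsilon> U V w P1 P2)"
    unfolding k0_def by (rule LeastI_ex[OF weak_regularity[OF assms(1)]])
  then obtain P1 P2 where "card P1 \<le> k0 \<epsilon>"
    "weak_regular_partition \<epsilon> {n..<2 * n} {..<n} w P1 P2"
    using w by fastforce
  then have "real n / 2 < real (k0 \<epsilon>)" using irr[of P1 P2] by force
  then have "y < real (k0 \<epsilon>)" using n_ge by linarith
  moreover have "card {n..<2 * n} = n" "card {..<n} = n" by auto
  ultimately show ?thesis unfolding half y_def[symmetric] using w irr by blast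
qed

end
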